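(* Let $m,n,s\ge 1$ be integers, $N=mn$, let $A\in\mathbb{R}^{N\times N}$, let $K_i\in\mathbb{R}^{n\times n}$ and $H_i\in\mathbb{R}^{m\times m}$ for $i=1,\dots,s$, let $A_s=\sum_{i=1}^sK_i\otimes H_i\in\mathbb{R}^{N\times N}$, let $B\in\mathbb{R}^{m\times n}$, $b=\mathrm{vec}(B)\in\mathbb{R}^N$, and let $\lambda>0$. Let $$\Phi(x)=\frac12\|Ax-b\|_2^2+\frac{\lambda^2}{2}\|x\|_2^2,\qquad \Phi_s(x)=\frac12\|A_sx-b\|_2^2+\frac{\lambda^2}{2}\|x\|_2^2,\qquad x\in\mathbb{R}^N,$$ and let $x^*$ and $x_s^*$ be the exact minimizers over $\mathbb{R}^N$ of $\Phi$ and $\Phi_s$, respectively. Let $L>0$ be a Lipschitz constant of the gradient of $x\mapsto\frac12\|A_sx-b\|_2^2$, let $\{X_k\},\{Y_k\}$ be the sequences generated by sFISTA with constant $L$ and initial point $X_0\in\mathbb{R}^{m\times n}$ applied to $$\min_{X\in\mathbb{R}^{m\times n}}\ \frac12\Big\|\sum_{i=1}^sH_iXK_i^T-B\Big\|_F^2+\frac{\lambda^2}{2}\|X\|_F^2,$$ and put $\tilde{x}_k=\mathrm{vec}(X_k)$ for $k\ge 0$. Suppose that the singular values of $A^TA_s+\lambda^2I$ have a positive lower bound and that $\|A-A_s\|_F=\epsilon_s$. Then there is a positive constant $c_0$, independent of $k$, such that for all $k\ge 1$ $$|\Phi(\tilde{x}_k)-\Phi(x^* )|\le\frac{2L\|\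tilde{x}_0-x_s^*\|_2^2}{(k+1)^2}+c_0\epsilon_s.$$
   Context: $\mathrm{vec}(X)$ denotes the column vector obtained by stacking the columns of the matrix $X$ one after the other. The Kronecker product $K\otimes H$ of $K\in\mathbb{R}^{n\times n}$ and $H\in\mathbb{R}^{m\times m}$ is the $mn\times mn$ block matrix whose $(i,j)$ block is $k_{ij}H$. $\|\cdot\|_F$ is the Frobenius norm and $I$ is the $N\times N$ identity matrix. (In the application, $A$ is a blurring matrix and $A_s$ is its Kronecker product approximation.) sFISTA with constant $L$ and initial point $X_0$: set $Y_1=X_0$, $t_1=1$, and for $k=1,2,\dots$ $$X_k=\frac{1}{L+\lambda^2}\Big(LY_k-\sum_{j=1}^sH_j^T\Big(\sum_{i=1}^sH_iY_kK_i^T-B\Big)K_j\Big),$$ $$t_{k+1}=\frac{1+\sqrt{1+4t_k^2}}{2},\qquad Y_{k+1}=X_k+\frac{t_k-1}{t_{k+1}}(X_k-X_{k-1}).$$ *)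

theory Defs
  imports "HOL-Analysis.Analysis"
begin

text \<open>
  An \<open>m \<times> n\<close> matrix has type \<open>real^'n^'m\<close> with \<open>m = CARD('m)\<close>, \<open>n = CARD('n)\<close>.
  The space \<open>R^N\<close> with \<open>N = m n\<close> is \<open>real^('n \<times> 'm)\<close>: the index \<open>(j, i)\<close> stands for
  position \<open>(j - 1) m + i\<close>, that is, for entry \<open>i\<close> of the block \<open>j\<close> of length \<open>m\<close>.
  The library norm on \<open>real^'b^'a\<close> is the Euclidean norm of all entries, i.e. the
  Frobenius norm on matrices (and not the operator norm).
\<close>

definition vec_cols :: "real^'n^'m \<Rightarrow> real^('n \<times> 'm)"
  where "vec_cols X = (\<chi> p. X $ snd p $ fst p)"

text \<open>Block \<open>(i, j)\<close> is \<open>K $ i $ j *\<^sub>R H\<close>; the first components of the two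
  indices select the block.\<close>

definition kronecker ::
    "real^'n^'n \<Rightarrow> real^'m^'m \<Rightarrow> real^('n \<times> 'm)^('n \<times> 'm)"  (infixl "\<otimes>\<^sub>K" 70)
  where "K \<otimes>\<^sub>K H = (\<chi> p q. K $ fst p $ fst q * H $ snd p $ snd q)"

definition singular_values :: "real^'a^'b \<Rightarrow> real set"
  where "singular_values M =
    {sqrt \<mu> | \<mu>. \<exists>v. v \<noteq> 0 \<and> (transpose M ** M) *v v = \<mu> *\<^sub>R v}"

definition gradient :: "('a::real_inner \<Rightarrow> real) \<Rightarrow> 'a \<Rightarrow> 'a"
  where "gradient f x = (THE D. GDERIV f x :> D)"

definition least_squares :: "real^'a^'b \<Rightarrow> real^'b \<Rightarrow> real^'a \<Rightarrow> real"
  where "least_squares A b x = 1/2 * (norm (A *v x - b))\<^sup>2"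

definition tikhonov :: "real^'a^'b \<Rightarrow> real^'b \<Rightarrow> real \<Rightarrow> real^'a \<Rightarrow> real"
  where "tikhonov A b lam x = least_squares A b x + lam\<^sup>2 / 2 * (norm x)\<^sup>2"

text \<open>\<open>X\<close>, \<open>Y\<close>, \<open>t\<close> are the sequences generated by sFISTA with constant \<open>L\<close> from the
  initial point \<open>X0\<close>. The values \<open>Y 0\<close> and \<open>t 0\<close> are not part of the algorithm and are
  left unconstrained.\<close>

definition sfista ::
    "nat \<Rightarrow> (nat \<Rightarrow> real^'n^'n) \<Rightarrow> (nat \<Rightarrow> real^'m^'m) \<Rightarrow> real^'n^'m \<Rightarrow> real \<Rightarrow> real \<Rightarrow> real^'n^'m
      \<Rightarrow> (nat \<Rightarrow> real^'n^'m) \<Rightarrow> (nat \<Rightarrow> real^'n^'m) \<Rightarrow> (nat \<Rightarrow> real) \<Rightarrow> bool"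
  where "sfista s K H B lam L X0 X Y t \<longleftrightarrow>
    X 0 = X0 \<and> Y 1 = X0 \<and> t 1 = 1 \<and>
    (\<forall>k\<ge>1.
      X k = (1 / (L + lam\<^sup>2)) *\<^sub>R
        (L *\<^sub>R Y k -
          (\<Sum>j=1..s. transpose (H j) ** ((\<Sum>i=1..s. H i ** Y k ** transpose (K i)) - B) ** K j)) \<and>
      t (k + 1) = (1 + sqrt (1 + 4 * (t k)\<^sup>2)) / 2 \<and>
      Y (k + 1) = X k + ((t k - 1) / t (k + 1)) *\<^sub>R (X k - X (k - 1)))"

end

theory Submission
  imports Defs
begin

text \<open>
  Under the isometry \<^const>\<open>vec_cols\<close>, the sFISTA step is the proximal gradient step for
  \<open>\<Phi>\<^sub>s = f + g\<close> with smooth part \<open>f = least_squares As b\<close> and \<open>g = \<lambda>\<^sup>2/2 \<parallel>\<cdot>\<parallel>\<^sup>2\<close>: the proximal map of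
  \<open>g / L\<close> is multiplication by \<open>L / (L + \<lambda>\<^sup>2)\<close>, and the adjoint of \<open>X \<mapsto> \<Sum>\<^sub>i H\<^sub>i X K\<^sub>i\<^sup>T\<close> is
  \<open>R \<mapsto> \<Sum>\<^sub>j H\<^sub>j\<^sup>T R K\<^sub>j\<close> (lemma \<open>sfista_step_vec\<close>).  So the accelerated rate of Beck and Teboulle
  (lemma \<open>accelerated_rate\<close>) gives
  \<open>\<Phi>\<^sub>s(x\<^sub>k) - \<Phi>\<^sub>s(x\<^sub>s\<^sup>*) \<le> 2 L \<parallel>x\<^sub>0 - x\<^sub>s\<^sup>*\<parallel>\<^sup>2 / (k + 1)\<^sup>2\<close>.

  To pass from \<open>\<Phi>\<^sub>s\<close> to \<open>\<Phi>\<close>, split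
  \<open>\<Phi>(x\<^sub>k) - \<Phi>(x\<^sup>*) = (\<Phi> - \<Phi>\<^sub>s)(x\<^sub>k) + (\<Phi>\<^sub>s(x\<^sub>k) - \<Phi>\<^sub>s(x\<^sub>s\<^sup>*)) + (\<Phi>\<^sub>s(x\<^sub>s\<^sup>*) - \<Phi>\<^sub>s(x\<^sup>*)) + (\<Phi>\<^sub>s - \<Phi>)(x\<^sup>*)\<close>.
  The second term is bounded by the rate and the third is at most zero.  On a ball, \<open>\<Phi> - \<Phi>\<^sub>s\<close> is
  bounded by a multiple of \<open>\<parallel>A - As\<parallel>\<^sub>F\<close> (lemma \<open>tikhonov_perturbation\<close>), and the iterates do lie in
  a ball: \<open>\<Phi>\<^sub>s(x\<^sub>k)\<close> is bounded by the rate, and \<open>\<Phi>\<^sub>s\<close> is coercive since \<open>\<lambda> > 0\<close>.  The left-hand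
  side is nonnegative because \<open>x\<^sup>*\<close> minimizes \<open>\<Phi>\<close>, so the upper bound suffices.
\<close>

section \<open>Accelerated proximal gradient iterations\<close>

text \<open>Each step of the recursion increases \<open>t\<close> by at least one half, as \<open>sqrt (1 + 4 t\<^sup>2) \<ge> 2 t\<close>.\<close>

lemma momentum_lower_bound:
  fixes t :: "nat \<Rightarrow> real"
  assumes t1: "t 1 = 1"
    and t_Suc: "\<And>k. k \<ge> 1 \<Longrightarrow> t (k + 1) = (1 + sqrt (1 + 4 * (t k)\<^sup>2)) / 2"
    and k: "k \<ge> 1"
  shows "(real k + 1) / 2 \<le> t k"
  using k
proof (induction k rule: dec_induct)
  case base
  then show ?case using t1 by simp
next
  case (step k)
  have "2 * t k \<le> sqrt (1 + 4 * (t k)\<^sup>2)"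
    by (rule real_le_rsqrt) (simp add: power_mult_distrib)
  with step t_Suc[of k] show ?case by simp
qed

lemma momentum_identity:
  fixes t T :: real
  assumes "T = (1 + sqrt (1 + 4 * t\<^sup>2)) / 2"
  shows "T * (T - 1) = t\<^sup>2"
proof -
  have "2 * T - 1 = sqrt (1 + 4 * t\<^sup>2)" using assms by simp
  then have "(2 * T - 1)\<^sup>2 = 1 + 4 * t\<^sup>2" by simp
  then show ?thesis by (simp add: algebra_simps power2_eq_square)
qed

text \<open>
  The inequality at the new point \<open>p\<close>, taken at the comparison points \<open>x\<close> and \<open>z\<close> with weights
  \<open>T - 1\<close> and \<open>1\<close> and multiplied by \<open>T\<close>, turns the right-hand side into a difference of two
  squares.
\<close>

lemma accelerated_descent:
  fixes F :: "'a::real_inner \<Rightarrow> real" and p x y z :: 'a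
  assumes T: "T \<ge> 1"
    and at_x: "L / 2 * (norm (p - y))\<^sup>2 + L * inner (y - x) (p - y) \<le> F x - F p"
    and at_z: "L / 2 * (norm (p - y))\<^sup>2 + L * inner (y - z) (p - y) \<le> F z - F p"
  shows "L / 2 * ((norm (T *\<^sub>R p - (T - 1) *\<^sub>R x - z))\<^sup>2 - (norm (T *\<^sub>R y - (T - 1) *\<^sub>R x - z))\<^sup>2)
    \<le> T * (T - 1) * (F x - F z) - T\<^sup>2 * (F p - F z)"
proof -
  define a where "a = T *\<^sub>R y - (T - 1) *\<^sub>R x - z"
  define d where "d = p - y"
  have a: "a = (T - 1) *\<^sub>R (y - x) + (y - z)"
    by (simp add: a_def algebra_simps)
  have p: "T *\<^sub>R p - (T - 1) *\<^sub>R x - z = a + T *\<^sub>R d"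
    by (simp add: a_def d_def algebra_simps)
  have sq: "(norm (a + T *\<^sub>R d))\<^sup>2 - (norm a)\<^sup>2 = T * (T * (norm d)\<^sup>2 + 2 * inner a d)"
    by (simp add: power2_norm_eq_inner inner_simps inner_commute algebra_simps)
  have ad: "inner a d = (T - 1) * inner (y - x) d + inner (y - z) d"
    unfolding a by (simp add: inner_add_left)
  have 1: "(T - 1) * (L / 2 * (norm d)\<^sup>2 + L * inner (y - x) d) \<le> (T - 1) * (F x - F p)"
    using T at_x by (intro mult_left_mono) (auto simp: d_def)
  have "L / 2 * (T * (norm d)\<^sup>2 + 2 * inner a d)
      = (T - 1) * (L / 2 * (norm d)\<^sup>2 + L * inner (y - x) d) + (L / 2 * (norm d)\<^sup>2 + L * inner (y - z) d)"
    unfolding ad by (simp add: field_simps)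
  also have "\<dots> \<le> (T - 1) * (F x - F p) + (F z - F p)"
    using 1 at_z unfolding d_def[symmetric] by (rule add_mono)
  finally have "T * (L / 2 * (T * (norm d)\<^sup>2 + 2 * inner a d))
      \<le> T * ((T - 1) * (F x - F p) + (F z - F p))"
    using T by (intro mult_left_mono) auto
  then show ?thesis
    unfolding p a_def[symmetric] sq by (simp add: algebra_simps power2_eq_square)
qed

text \<open>
  Along the iteration, \<open>2/L t\<^sub>k\<^sup>2 (F x\<^sub>k - F z) + \<parallel>t\<^sub>k x\<^sub>k - (t\<^sub>k - 1) x\<^sub>k\<^sub>-\<^sub>1 - z\<parallel>\<^sup>2\<close> does not increase: the
  extrapolation point \<open>y\<^sub>k\<^sub>+\<^sub>1\<close> is chosen so that the subtracted square in \<open>accelerated_descent\<close> is the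
  second summand at \<open>k\<close>, and \<open>t\<^sub>k\<^sub>+\<^sub>1\<close> so that the weight of \<open>F x\<^sub>k - F z\<close> is \<open>t\<^sub>k\<^sup>2\<close>.  The
  assumption \<open>prox\<close> is what one proximal gradient step with a \<open>1/L\<close> step size guarantees against
  every comparison point.
\<close>

theorem accelerated_rate:
  fixes F :: "'a::real_inner \<Rightarrow> real" and x y :: "nat \<Rightarrow> 'a" and z :: 'a
  assumes L: "L > 0"
    and prox: "\<And>k w. k \<ge> 1 \<Longrightarrow>
      L / 2 * (norm (x k - y k))\<^sup>2 + L * inner (y k - w) (x k - y k) \<le> F w - F (x k)"
    and y1: "y 1 = x 0"
    and t1: "t 1 = 1"
    and t_Suc: "\<And>k. k \<ge> 1 \<Longrightarrow> t (k + 1) = (1 + sqrt (1 + 4 * (t k)\<^sup>2)) / 2"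
    and y_Suc: "\<And>k. k \<ge> 1 \<Longrightarrow> y (k + 1) = x k + ((t k - 1) / t (k + 1)) *\<^sub>R (x k - x (k - 1))"
    and k: "k \<ge> 1"
  shows "F (x k) - F z \<le> 2 * L * (norm (x 0 - z))\<^sup>2 / (real k + 1)\<^sup>2"
proof -
  have t_lower: "(real j + 1) / 2 \<le> t j" if "j \<ge> 1" for j
    by (rule momentum_lower_bound[of t, OF t1 t_Suc that])
  have energy: "(t k)\<^sup>2 * (F (x k) - F z)
      + L / 2 * (norm (t k *\<^sub>R x k - (t k - 1) *\<^sub>R x (k - 1) - z))\<^sup>2
    \<le> L / 2 * (norm (x 0 - z))\<^sup>2"
    using k
  proof (induction k rule: dec_induct)
    case base
    \<comment> \<open>For \<open>T = 1\<close> the comparison point \<open>x\<close> drops out, so any choice of it serves.\<close>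
    show ?case
      using accelerated_descent[OF order_refl[of 1] prox[OF order_refl, of z] prox[OF order_refl, of z]] y1 t1
      by (simp add: right_diff_distrib)
  next
    case (step k)
    let ?T = "t (k + 1)"
    have T: "?T \<ge> 1" using t_lower[of "k + 1"] step.hyps by simp
    have "?T *\<^sub>R y (k + 1) = ?T *\<^sub>R x k + (t k - 1) *\<^sub>R (x k - x (k - 1))"
      unfolding y_Suc[OF step.hyps(1)] using T by (simp add: scaleR_add_right)
    then have a: "?T *\<^sub>R y (k + 1) - (?T - 1) *\<^sub>R x k - z = t k *\<^sub>R x k - (t k - 1) *\<^sub>R x (k - 1) - z"
      by (simp add: algebra_simps)
    have T_sq: "?T * (?T - 1) = (t k)\<^sup>2"
      using t_Suc[OF step.hyps(1)] by (rule momentum_identity)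
    have "1 \<le> k + 1" by simp
    from accelerated_descent[OF T prox[OF this, of "x k"] prox[OF this, of z], unfolded a T_sq]
    have "?T\<^sup>2 * (F (x (k + 1)) - F z)
        + L / 2 * (norm (?T *\<^sub>R x (k + 1) - (?T - 1) *\<^sub>R x k - z))\<^sup>2
      \<le> (t k)\<^sup>2 * (F (x k) - F z)
        + L / 2 * (norm (t k *\<^sub>R x k - (t k - 1) *\<^sub>R x (k - 1) - z))\<^sup>2"
      by (simp only: right_diff_distrib)
    with step.IH show ?case by simp
  qed
  have tk: "(real k + 1) / 2 \<le> t k" using k by (rule t_lower)
  have "0 < (real k + 1) / 2" by simp
  with tk have "t k > 0" by linarith
  have "0 \<le> L / 2 * (norm (t k *\<^sub>R x k - (t k - 1) *\<^sub>R x (k - 1) - z))\<^sup>2"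
    using L by simp
  with energy have "(t k)\<^sup>2 * (F (x k) - F z) \<le> L / 2 * (norm (x 0 - z))\<^sup>2"
    by linarith
  then have "F (x k) - F z \<le> L / 2 * (norm (x 0 - z))\<^sup>2 / (t k)\<^sup>2"
    using \<open>t k > 0\<close> by (simp add: field_simps)
  also have "\<dots> \<le> L / 2 * (norm (x 0 - z))\<^sup>2 / ((real k + 1) / 2)\<^sup>2"
    using L tk \<open>t k > 0\<close> by (intro divide_left_mono power_mono mult_pos_pos) auto
  also have "\<dots> = 2 * L * (norm (x 0 - z))\<^sup>2 / (real k + 1)\<^sup>2"
    by (simp add: power_divide)
  finally show ?thesis .
qed

section \<open>Tikhonov functionals\<close>

lemma inner_matrix_vector_left:
  fixes A :: "real^'a^'b"
  shows "inner (A *v x) y = inner x (transpose A *v y)"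
  by (metis dot_lmul_matrix inner_commute transpose_matrix_vector)

text \<open>
  The norm of a matrix is the Euclidean norm of its row norms, so Cauchy--Schwarz in every row
  suffices.
\<close>

lemma norm_matrix_vector_le_frobenius:
  fixes A :: "real^'a^'b"
  shows "norm (A *v x) \<le> norm A * norm x"
proof -
  have "norm (A *v x) = L2_set (\<lambda>i. \<bar>inner (A $ i) x\<bar>) UNIV"
    by (simp add: norm_vec_def matrix_vector_mul_component)
  also have "\<dots> \<le> L2_set (\<lambda>i. norm (A $ i) * norm x) UNIV"
    by (intro L2_set_mono) (auto simp: Cauchy_Schwarz_ineq2)
  also have "\<dots> = norm A * norm x"
    by (simp add: norm_vec_def L2_set_left_distrib)
  finally show ?thesis .
qed

lemma least_squares_expand:
  fixes A :: "real^'a^'b"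
  shows "least_squares A b (y + h) = least_squares A b y
    + inner h (transpose A *v (A *v y - b)) + 1/2 * (norm (A *v h))\<^sup>2"
proof -
  have "A *v (y + h) - b = (A *v y - b) + A *v h"
    by (simp add: matrix_vector_right_distrib)
  moreover have "1/2 * (norm (u + v))\<^sup>2 = 1/2 * (norm u)\<^sup>2 + inner v u + 1/2 * (norm v)\<^sup>2"
    for u v :: "real^'b"
    by (simp add: power2_norm_eq_inner inner_add_left inner_add_right inner_commute)
  ultimately show ?thesis
    unfolding least_squares_def by (simp only: inner_matrix_vector_left[symmetric])
qed

lemma gradient_least_squares:
  fixes A :: "real^'a^'b"
  shows "gradient (least_squares A b) x = transpose A *v (A *v x - b)"
proof -
  have "(least_squares A b has_derivative (\<lambda>h. inner h (transpose A *v (A *v x - b)))) (at x)"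
    unfolding least_squares_def[abs_def] power2_norm_eq_inner
    by (auto intro!: derivative_eq_intros bounded_linear.has_derivative[OF matrix_vector_mul_bounded_linear]
        simp: inner_matrix_vector_left[symmetric] inner_commute simp del: transpose_matrix_vector)
  then have D: "GDERIV (least_squares A b) x :> transpose A *v (A *v x - b)"
    by (simp add: gderiv_def)
  show ?thesis
    unfolding gradient_def
  proof (rule the_equality, rule D)
    fix E assume "GDERIV (least_squares A b) x :> E"
    with D have "(\<lambda>h. inner h E) = (\<lambda>h. inner h (transpose A *v (A *v x - b)))"
      unfolding gderiv_def by (metis has_derivative_unique)
    then show "E = transpose A *v (A *v x - b)"
      by (metis vector_eq_ldot)
  qed
qed

text \<open>
  Since \<open>\<parallel>A h\<parallel>\<^sup>2 = \<langle>h, A\<^sup>T A h\<rangle>\<close>, the Lipschitz constant of the gradient bounds the quadratic term in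
  \<open>least_squares_expand\<close>.
\<close>

lemma lipschitz_gradient_least_squares:
  fixes A :: "real^'a^'b"
  assumes "L-lipschitz_on UNIV (gradient (least_squares A b))"
  shows "(norm (A *v h))\<^sup>2 \<le> L * (norm h)\<^sup>2"
proof -
  have "dist (gradient (least_squares A b) h) (gradient (least_squares A b) 0) \<le> L * dist h 0"
    using assms by (rule lipschitz_onD) auto
  moreover have "gradient (least_squares A b) h - gradient (least_squares A b) 0
      = transpose A *v (A *v h)"
    unfolding gradient_least_squares matrix_vector_mult_diff_distrib[symmetric] by simp
  ultimately have lip: "norm (transpose A *v (A *v h)) \<le> L * norm h"
    unfolding dist_norm by simp
  have "(norm (A *v h))\<^sup>2 = inner h (transpose A *v (A *v h))"
    unfolding power2_norm_eq_inner by (rule inner_matrix_vector_left)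
  also have "\<dots> \<le> norm h * norm (transpose A *v (A *v h))"
    by (rule norm_cauchy_schwarz)
  also have "\<dots> \<le> norm h * (L * norm h)"
    using lip by (intro mult_left_mono) auto
  finally show ?thesis by (simp add: power2_eq_square algebra_simps)
qed

text \<open>
  Both parts of the functional are quadratic, so they can be expanded exactly, the smooth part at \<open>y\<close>
  and the regularizer at \<open>p\<close>; the defining equation of \<open>p\<close> says that
  \<open>\<nabla>f(y) + \<lambda>\<^sup>2 p = L (y - p)\<close>.
\<close>

lemma tikhonov_prox_step:
  fixes A :: "real^'a^'b"
  assumes lip: "\<And>h. (norm (A *v h))\<^sup>2 \<le> L * (norm h)\<^sup>2"
    and p: "(L + lam\<^sup>2) *\<^sub>R p = L *\<^sub>R y - transpose A *v (A *v y - b)"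
  shows "L / 2 * (norm (p - y))\<^sup>2 + L * inner (y - w) (p - y)
    \<le> tikhonov A b lam w - tikhonov A b lam p"
proof -
  define g where "g = transpose A *v (A *v y - b)"
  have "least_squares A b w \<ge> least_squares A b y + inner (w - y) g"
    using least_squares_expand[of A b y "w - y"] by (simp add: g_def)
  moreover have "least_squares A b p \<le> least_squares A b y + inner (p - y) g + L / 2 * (norm (p - y))\<^sup>2"
    using least_squares_expand[of A b y "p - y"] lip[of "p - y"] by (simp add: g_def)
  moreover have "lam\<^sup>2 / 2 * (norm w)\<^sup>2
      = lam\<^sup>2 / 2 * (norm p)\<^sup>2 + lam\<^sup>2 * inner (w - p) p + lam\<^sup>2 / 2 * (norm (w - p))\<^sup>2"
    by (simp add: power2_norm_eq_inner inner_diff_left inner_diff_right inner_commute field_simps)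
  moreover have "lam\<^sup>2 / 2 * (norm (w - p))\<^sup>2 \<ge> 0" by simp
  ultimately have "tikhonov A b lam w - tikhonov A b lam p
      \<ge> inner (w - p) g + lam\<^sup>2 * inner (w - p) p - L / 2 * (norm (p - y))\<^sup>2"
    using inner_diff_left[of "w - y" "p - y" g] unfolding tikhonov_def diff_diff_eq2 diff_add_cancel
    by linarith
  moreover have "inner (w - p) g + lam\<^sup>2 * inner (w - p) p = L * inner (w - p) (y - p)"
  proof -
    have "g = L *\<^sub>R (y - p) - lam\<^sup>2 *\<^sub>R p"
      using p by (simp add: g_def algebra_simps)
    then show ?thesis by (simp add: inner_diff_right)
  qed
  moreover have "L * inner (w - p) (y - p) = L * (norm (p - y))\<^sup>2 + L * inner (y - w) (p - y)"
    by (simp add: power2_norm_eq_inner inner_diff_left inner_diff_right inner_commute algebra_simps)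
  ultimately show ?thesis by simp
qed

text \<open>
  The difference of the two squared residuals factors as the inner product of
  \<open>(A - A') x\<close> and \<open>(A + A') x - 2 b\<close>.
\<close>

lemma tikhonov_perturbation:
  fixes A A' :: "real^'a^'b"
  assumes "norm x \<le> R"
  shows "\<bar>tikhonov A b lam x - tikhonov A' b lam x\<bar>
    \<le> 1/2 * R * ((norm A + norm A') * R + 2 * norm b) * norm (A - A')"
proof -
  have R: "R \<ge> 0" using assms norm_ge_zero order_trans by blast
  let ?u = "A *v x - b" and ?v = "A' *v x - b"
  have mult_le: "norm (M *v x) \<le> norm M * R" for M :: "real^'a^'b"
    using norm_matrix_vector_le_frobenius[of M x] assms
    by (meson mult_left_mono norm_ge_zero order_trans)
  have "tikhonov A b lam x - tikhonov A' b lam x = 1/2 * inner (?u - ?v) (?u + ?v)"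
    unfolding tikhonov_def least_squares_def power2_norm_eq_inner
      inner_diff_left[of ?u] inner_add_right[of _ ?u]
    by (simp add: inner_commute[of ?v ?u])
  then have "\<bar>tikhonov A b lam x - tikhonov A' b lam x\<bar> \<le> 1/2 * (norm (?u - ?v) * norm (?u + ?v))"
    using Cauchy_Schwarz_ineq2[of "?u - ?v" "?u + ?v"] by linarith
  also have "\<dots> \<le> 1/2 * ((norm (A - A') * R) * ((norm A + norm A') * R + 2 * norm b))"
  proof (intro mult_left_mono mult_mono)
    show "norm (?u - ?v) \<le> norm (A - A') * R"
      using mult_le[of "A - A'"] by (simp add: matrix_vector_mult_diff_rdistrib)
    have "norm (?u + ?v) \<le> norm ?u + norm ?v" by (rule norm_triangle_ineq)
    also have "\<dots> \<le> (norm (A *v x) + norm b) + (norm (A' *v x) + norm b)"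
      by (intro add_mono norm_triangle_ineq4)
    finally show "norm (?u + ?v) \<le> (norm A + norm A') * R + 2 * norm b"
      using mult_le[of A] mult_le[of A'] by (simp add: algebra_simps)
  qed (use R in auto)
  finally show ?thesis by (simp add: algebra_simps)
qed

section \<open>Vectorization\<close>

lemma linear_vec_cols: "linear vec_cols"
  by (rule linearI) (simp_all add: vec_cols_def vec_eq_iff)

lemma transpose_kronecker: "transpose (K \<otimes>\<^sub>K H) = transpose K \<otimes>\<^sub>K transpose H"
  by (simp add: transpose_def kronecker_def vec_eq_iff)

lemma kronecker_mult_vec_cols: "(K \<otimes>\<^sub>K H) *v vec_cols X = vec_cols (H ** X ** transpose K)"
proof -
  have "(\<Sum>q\<in>UNIV. K $ j $ fst q * H $ i $ snd q * X $ snd q $ fst q)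
      = (\<Sum>c\<in>UNIV. (\<Sum>d\<in>UNIV. H $ i $ d * X $ d $ c) * K $ j $ c)" for i j
  proof -
    have "(\<Sum>q\<in>UNIV. K $ j $ fst q * H $ i $ snd q * X $ snd q $ fst q)
        = (\<Sum>c\<in>UNIV. \<Sum>d\<in>UNIV. K $ j $ c * H $ i $ d * X $ d $ c)"
      by (simp add: sum.cartesian_product case_prod_beta flip: UNIV_Times_UNIV)
    then show ?thesis by (simp add: sum_distrib_left sum_distrib_right mult_ac)
  qed
  then show ?thesis
    by (simp add: vec_eq_iff vec_cols_def kronecker_def matrix_vector_mult_def matrix_matrix_mult_def
        transpose_def)
qed

lemma matrix_vector_mult_sum_left:
  fixes M :: "'i \<Rightarrow> real^'a^'b"
  shows "(\<Sum>i\<in>I. M i) *v x = (\<Sum>i\<in>I. M i *v x)"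
  by (induction I rule: infinite_finite_induct) (auto simp: matrix_vector_mult_add_rdistrib)

lemma transpose_sum:
  fixes M :: "'i \<Rightarrow> real^'a^'b"
  shows "transpose (\<Sum>i\<in>I. M i) = (\<Sum>i\<in>I. transpose (M i))"
  by (simp add: vec_eq_iff transpose_def)

text \<open>
  The inner matrix sum is the product with \<open>As\<close> by \<open>kronecker_mult_vec_cols\<close>, and the outer one is the
  product with its transpose because transposition commutes with \<open>\<otimes>\<^sub>K\<close>.  The factor \<open>c = L + \<lambda>\<^sup>2\<close> is
  cleared because \<open>tikhonov_prox_step\<close> reads the step as an optimality condition.
\<close>

lemma sfista_step_vec:
  fixes K :: "nat \<Rightarrow> real^'n^'n" and H :: "nat \<Rightarrow> real^'m^'m" and B X Y :: "real^'n^'m"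
  assumes As: "As = (\<Sum>i=1..s. K i \<otimes>\<^sub>K H i)"
    and c: "c \<noteq> 0"
    and X: "X = (1 / c) *\<^sub>R (L *\<^sub>R Y -
      (\<Sum>j=1..s. transpose (H j) ** ((\<Sum>i=1..s. H i ** Y ** transpose (K i)) - B) ** K j))"
  shows "c *\<^sub>R vec_cols X
    = L *\<^sub>R vec_cols Y - transpose As *v (As *v vec_cols Y - vec_cols B)"
proof -
  have mult: "As *v vec_cols Z = vec_cols (\<Sum>i=1..s. H i ** Z ** transpose (K i))" for Z
    by (simp add: As matrix_vector_mult_sum_left kronecker_mult_vec_cols linear_sum[OF linear_vec_cols])
  have mult_t: "transpose As *v vec_cols Z = vec_cols (\<Sum>j=1..s. transpose (H j) ** Z ** K j)" for Z
    by (simp add: As transpose_sum transpose_kronecker matrix_vector_mult_sum_left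
        kronecker_mult_vec_cols linear_sum[OF linear_vec_cols])
  have "c *\<^sub>R X = L *\<^sub>R Y -
      (\<Sum>j=1..s. transpose (H j) ** ((\<Sum>i=1..s. H i ** Y ** transpose (K i)) - B) ** K j)"
    using c X by simp
  then have "vec_cols (c *\<^sub>R X) = vec_cols (L *\<^sub>R Y -
      (\<Sum>j=1..s. transpose (H j) ** ((\<Sum>i=1..s. H i ** Y ** transpose (K i)) - B) ** K j))"
    by (rule arg_cong)
  moreover have "As *v vec_cols Y - vec_cols B
      = vec_cols ((\<Sum>i=1..s. H i ** Y ** transpose (K i)) - B)"
    by (simp only: mult linear_diff[OF linear_vec_cols])
  ultimately show ?thesis
    by (simp only: mult_t linear_diff[OF linear_vec_cols, of "L *\<^sub>R Y"] linear_cmul[OF linear_vec_cols])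
qed

section \<open>The error bound\<close>

lemma sfista_rate:
  fixes K :: "nat \<Rightarrow> real^'n^'n" and H :: "nat \<Rightarrow> real^'m^'m"
  assumes As: "As = (\<Sum>i=1..s. K i \<otimes>\<^sub>K H i)"
    and L: "L > 0"
    and lip: "L-lipschitz_on UNIV (gradient (least_squares As (vec_cols B)))"
    and alg: "sfista s K H B lam L X0 X Y t"
    and k: "k \<ge> 1"
  shows "tikhonov As (vec_cols B) lam (vec_cols (X k)) - tikhonov As (vec_cols B) lam z
    \<le> 2 * L * (norm (vec_cols (X 0) - z))\<^sup>2 / (real k + 1)\<^sup>2"
proof -
  let ?x = "\<lambda>k. vec_cols (X k)" and ?y = "\<lambda>k. vec_cols (Y k)"
  have c: "L + lam\<^sup>2 \<noteq> 0" using L by (metis add_pos_nonneg less_irrefl zero_le_power2)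
  show ?thesis
  proof (rule accelerated_rate[where x = ?x and y = ?y and t = t])
    fix j :: nat and w assume j: "j \<ge> 1"
    have "(L + lam\<^sup>2) *\<^sub>R ?x j = L *\<^sub>R ?y j - transpose As *v (As *v ?y j - vec_cols B)"
      using alg j by (intro sfista_step_vec[OF As c]) (auto simp: sfista_def)
    then show "L / 2 * (norm (?x j - ?y j))\<^sup>2 + L * inner (?y j - w) (?x j - ?y j)
        \<le> tikhonov As (vec_cols B) lam w - tikhonov As (vec_cols B) lam (?x j)"
      by (intro tikhonov_prox_step lipschitz_gradient_least_squares[OF lip])
  next
    fix j :: nat assume j: "j \<ge> 1"
    have "Y (j + 1) = X j + ((t j - 1) / t (j + 1)) *\<^sub>R (X j - X (j - 1))"
      using alg j by (simp add: sfista_def)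
    then show "?y (j + 1) = ?x j + ((t j - 1) / t (j + 1)) *\<^sub>R (?x j - ?x (j - 1))"
      by (simp only: linear_add[OF linear_vec_cols] linear_diff[OF linear_vec_cols]
          linear_cmul[OF linear_vec_cols])
  qed (use alg k L in \<open>auto simp: sfista_def\<close>)
qed

theorem theorem3p3:
  fixes A As :: "real^('n::finite \<times> 'm::finite)^('n::finite \<times> 'm::finite)"
    and s :: nat
    and K :: "nat \<Rightarrow> real^'n::finite^'n"
    and H :: "nat \<Rightarrow> real^'m::finite^'m"
    and B X0 :: "real^'n::finite^'m::finite"
    and b xstar xsstar :: "real^('n::finite \<times> 'm::finite)"
    and lam L eps :: real
    and X Y :: "nat \<Rightarrow> real^'n::finite^'m::finite"
    and t :: "nat \<Rightarrow> real"
  assumes "s \<ge> 1"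
    and "As = (\<Sum>i=1..s. K i \<otimes>\<^sub>K H i)"
    and "b = vec_cols B"
    and "lam > 0"
    and "is_arg_min (tikhonov A b lam) (\<lambda>x. True) xstar"
    and "is_arg_min (tikhonov As b lam) (\<lambda>x. True) xsstar"
    and "L > 0"
    and "L-lipschitz_on UNIV (gradient (least_squares As b))"
    and "sfista s K H B lam L X0 X Y t"
    and "\<exists>\<delta>>0. \<forall>\<sigma>\<in>singular_values (transpose A ** As + lam\<^sup>2 *\<^sub>R mat 1). \<delta> \<le> \<sigma>"
    and "norm (A - As) = eps"
  shows "\<exists>c0>0. \<forall>k\<ge>1.
    \<bar>tikhonov A b lam (vec_cols (X k)) - tikhonov A b lam xstar\<bar>
      \<le> 2 * L * (norm (vec_cols (X 0) - xsstar))\<^sup>2 / (real k + 1)\<^sup>2 + c0 * eps"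
proof -
  let ?x = "\<lambda>k. vec_cols (X k)"
  let ?\<Phi> = "tikhonov A b lam" and ?\<Phi>\<^sub>s = "tikhonov As b lam"
  let ?rate = "\<lambda>k. 2 * L * (norm (?x 0 - xsstar))\<^sup>2 / (real k + 1)\<^sup>2"
  have rate: "?\<Phi>\<^sub>s (?x k) - ?\<Phi>\<^sub>s xsstar \<le> ?rate k" if "k \<ge> 1" for k
    using sfista_rate[OF assms(2) assms(7) _ assms(9) that] assms(3,8) by blast
  have min: "?\<Phi> xstar \<le> ?\<Phi> x" and min_s: "?\<Phi>\<^sub>s xsstar \<le> ?\<Phi>\<^sub>s x" for x
    using assms(5,6) by (auto simp: is_arg_min_def not_less)
  \<comment> \<open>By the rate, \<open>E\<close> bounds \<open>\<Phi>\<^sub>s\<close> along the iteration; so \<open>R\<close>, taken from the regularizer alone,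
    bounds the iterates.  It also covers \<open>x\<^sup>*\<close>, the other point at which \<open>\<Phi>\<close> and \<open>\<Phi>\<^sub>s\<close> are compared.\<close>
  define E where "E = ?\<Phi>\<^sub>s xsstar + 2 * L * (norm (?x 0 - xsstar))\<^sup>2"
  define R where "R = max (norm xstar) (sqrt (2 * E / lam\<^sup>2))"
  have iterates_bounded: "norm (?x k) \<le> R" if k: "k \<ge> 1" for k
  proof -
    have "?rate k \<le> 2 * L * (norm (?x 0 - xsstar))\<^sup>2 / 1"
      using assms(7) by (intro divide_left_mono) auto
    with rate[OF k] have "?\<Phi>\<^sub>s (?x k) \<le> E" by (simp add: E_def)
    moreover have "lam\<^sup>2 / 2 * (norm (?x k))\<^sup>2 \<le> ?\<Phi>\<^sub>s (?x k)"
      by (simp add: tikhonov_def least_squares_def)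
    ultimately have "(norm (?x k))\<^sup>2 \<le> 2 * E / lam\<^sup>2"
      using assms(4) by (simp add: field_simps)
    then have "norm (?x k) \<le> sqrt (2 * E / lam\<^sup>2)" by (rule real_le_rsqrt)
    then show ?thesis by (simp add: R_def)
  qed
  have R: "R \<ge> 0" unfolding R_def by (simp add: le_max_iff_disj)
  define C where "C = 1/2 * R * ((norm A + norm As) * R + 2 * norm b)"
  have C: "C \<ge> 0" using R by (simp add: C_def)
  have perturb: "\<bar>?\<Phi> x - ?\<Phi>\<^sub>s x\<bar> \<le> C * eps" if "norm x \<le> R" for x
    using tikhonov_perturbation[OF that, of A b lam As] assms(11) by (simp add: C_def)
  show ?thesis
  proof (intro exI[of _ "2 * C + 1"] conjI allI impI)
    \<comment> \<open>One \<open>C\<close> for the perturbation at \<open>x\<^sub>k\<close>, one for that at \<open>x\<^sup>*\<close>; the extra \<open>1\<close> makes the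
      constant positive when \<open>C = 0\<close>.\<close>
    show "2 * C + 1 > 0" using C by simp
    fix k :: nat assume k: "k \<ge> 1"
    have "?\<Phi> (?x k) - ?\<Phi> xstar \<le> ?rate k + 2 * (C * eps)"
      using perturb[OF iterates_bounded[OF k]] perturb[of xstar] rate[OF k] min_s[of xstar]
      by (simp add: R_def)
    moreover have "eps \<ge> 0" using assms(11) norm_ge_zero by blast
    ultimately show "\<bar>?\<Phi> (?x k) - ?\<Phi> xstar\<bar> \<le> ?rate k + (2 * C + 1) * eps"
      using min[of "?x k"] by (simp add: algebra_simps)
  qed
qed

end
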